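(* Let $m_{L}=\int_{0}^{\infty}\left(\frac{x}{x+1}\right)^{L}\,dF(x)$ for integers $L\ge 1$. Then the generating power function, defined by $G(z)=\sum_{L=1}^{\infty}m_{L}z^{L-1}$ for $|z|<1$, has an analytic continuation to the domain $\mathbb{C}\setminus[1,\infty)$. For all $z\in\mathbb{C}\setminus[0,\infty)$ it satisfies the functional equation $$-\frac{1}{1-z}-\frac{1}{(1-z)^{2}}\,G\left(\frac{1}{1-z}\right)+2G(z+1)=G(z),$$ and also the symmetry property $$G(z+1)=-\frac{1}{z^{2}}\,G\left(\frac{1}{z}+1\right)-\frac{1}{z}.$$ Moreover, $G(z)\to 0$ as $z\to\infty$ in such a way that the distance from $z$ to $\mathbb{R}_{+}=[0,\infty)$ tends to infinity.
   Context: $F:[0,\infty)\to[0,1)$ is the (rescaled) Minkowski question mark function: if $x=[a_0,a_1,a_2,\dots]$ is the regular continued fraction expansion of $x\ge 0$, then $$F(x)=1-2^{-a_{0}}+2^{-(a_{0}+a_{1})}-2^{-(a_{0}+a_{1}+a_{2})}+\cdots,$$ where for rational $x=[a_0,\dots,a_n]$ the sum terminates at the last element $a_n$. $F$ is a continuous, monotone distribution function with $F(0)=0$, $F(\infty)=1$. Integrals against $dF$ are Stieltjes integrals. *)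

theory Defs
  imports "HOL-Complex_Analysis.Complex_Analysis"
begin

text \<open>Complete quotients of the regular continued fraction of \<open>x\<close>: the partial quotients
  are \<open>a\<^sub>n = \<lfloor>cf_rem x n\<rfloor>\<close>. They are meaningful only as long as the expansion has not
  terminated; after termination \<open>cf_rem\<close> takes the junk value \<open>1 / 0 = 0\<close>.\<close>

primrec cf_rem :: "real \<Rightarrow> nat \<Rightarrow> real" where
  "cf_rem x 0 = x"
| "cf_rem x (Suc n) = 1 / frac (cf_rem x n)"

definition cf_elem :: "real \<Rightarrow> nat \<Rightarrow> nat" where
  "cf_elem x n = nat \<lfloor>cf_rem x n\<rfloor>"

text \<open>The expansion of \<open>x\<close> has an element of index \<open>n\<close>.\<close>

definition cf_defined :: "real \<Rightarrow> nat \<Rightarrow> bool" where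
  "cf_defined x n \<longleftrightarrow> (\<forall>k<n. frac (cf_rem x k) \<noteq> 0)"

text \<open>\<open>1 - 2^(-a\<^sub>0) + 2^(-(a\<^sub>0+a\<^sub>1)) - \<dots>\<close>, cut off after the last element if \<open>x\<close> is rational.
  Extending by \<open>0\<close> to negative arguments makes it a distribution function on the whole
  line, as \<open>interval_measure\<close> requires.\<close>

definition minkowski_F :: "real \<Rightarrow> real" where
  "minkowski_F x =
     (if x < 0 then 0
      else 1 + (\<Sum>n. if cf_defined x n
                      then (- 1) ^ Suc n * (1 / 2) ^ (\<Sum>k\<le>n. cf_elem x k)
                      else 0))"

text \<open>The integral is taken with respect to the Lebesgue--Stieltjes measure of \<open>F\<close>.\<close>

definition minkowski_moment :: "nat \<Rightarrow> real" where
  "minkowski_moment L =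
     (LINT x:{0..}|interval_measure minkowski_F. (x / (x + 1)) ^ L)"

end

theory Submission
  imports Defs "HOL-Probability.Probability"
begin

text \<open>The continued fraction expansion gives \<open>F(x + 1) = (1 + F(x)) / 2\<close> and
  \<open>F(1 / x) = 1 - F(x)\<close>, hence \<open>F(x / (x + 1)) = F(x) / 2\<close>. As \<open>x \<mapsto> x / (x + 1)\<close> and
  \<open>x \<mapsto> x + 1\<close> are increasing bijections of \<open>[0, \<infinity>)\<close> onto \<open>[0, 1)\<close> and \<open>[1, \<infinity>)\<close>, each
  application of these equations halves the error in any estimate for \<open>F\<close>; monotonicity and
  continuity follow from mere boundedness. For the measure \<open>dF\<close>, the same equations say that it
  is invariant under \<open>x \<mapsto> 1 / x\<close> and is the average of its images under \<open>x \<mapsto> x + 1\<close> and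
  \<open>x \<mapsto> x / (x + 1)\<close>. By the inversion symmetry \<open>G(z) = \<integral> dF(x) / (x + 1 - z)\<close>. Both functional
  equations are these two properties of \<open>dF\<close> applied to the Cauchy kernel, and analyticity
  and decay are read off the kernel.\<close>

section \<open>The question mark function\<close>

definition cf_term :: "real \<Rightarrow> nat \<Rightarrow> real" where
  "cf_term x n = (if cf_defined x n
                  then (- 1) ^ Suc n * (1 / 2) ^ (\<Sum>k\<le>n. cf_elem x k) else 0)"

lemma minkowski_F_nonneg_eq: "x \<ge> 0 \<Longrightarrow> minkowski_F x = 1 + (\<Sum>n. cf_term x n)"
  by (simp add: minkowski_F_def cf_term_def)

lemma cf_elem_ge_1:
  assumes "frac (cf_rem x n) \<noteq> 0"
  shows "cf_elem x (Suc n) \<ge> 1"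
proof -
  have "0 < frac (cf_rem x n)" "frac (cf_rem x n) < 1"
    using assms frac_ge_0[of "cf_rem x n"] by (linarith, simp add: frac_lt_1)
  then have "1 / frac (cf_rem x n) \<ge> 1" by simp
  then have "\<lfloor>1 / frac (cf_rem x n)\<rfloor> \<ge> 1" by (simp add: le_floor_iff)
  then show ?thesis by (simp add: cf_elem_def nat_le_eq_zle le_nat_iff)
qed

text \<open>All elements after the first are at least 1, so the exponents grow at least linearly.
  This gives geometric domination of the series.\<close>

lemma sum_cf_elem_ge:
  assumes "cf_defined x n"
  shows "n \<le> (\<Sum>k\<le>n. cf_elem x k)"
  using assms
proof (induction n)
  case (Suc n)
  then have "cf_defined x n" "frac (cf_rem x n) \<noteq> 0" by (auto simp: cf_defined_def)
  then show ?case using Suc.IH cf_elem_ge_1[of x n] by simp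
qed simp

lemma abs_cf_term_le: "\<bar>cf_term x n\<bar> \<le> (1 / 2) ^ n"
  using sum_cf_elem_ge[of x n]
  by (auto simp: cf_term_def abs_mult power_abs intro: power_decreasing)

lemma summable_cf_term: "summable (cf_term x)"
  by (rule summable_comparison_test'[of "\<lambda>n. (1/2) ^ n" 0]) (auto simp: abs_cf_term_le)

text \<open>The 3 is the leading 1 plus the geometric sum 2. This bound starts the error halving in
  \<open>minkowski_F_approx_bounds\<close>.\<close>

lemma abs_minkowski_F_le: "\<bar>minkowski_F x\<bar> \<le> 3"
proof (cases "x < 0")
  case True
  then show ?thesis by (simp add: minkowski_F_def)
next
  case False
  have "\<bar>\<Sum>n. cf_term x n\<bar> \<le> (\<Sum>n. (1/2) ^ n)"
    using norm_suminf_le[of "cf_term x" "\<lambda>n. (1/2) ^ n"]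
    by (simp add: abs_cf_term_le summable_geometric)
  also have "\<dots> = (2::real)" using suminf_geometric[of "1/2::real"] by simp
  finally show ?thesis using False by (simp add: minkowski_F_nonneg_eq)
qed

section \<open>Functional equations of \<open>F\<close>\<close>

lemma cf_rem_add_one: "cf_rem (x + 1) (Suc n) = cf_rem x (Suc n)"
  by (induction n) (auto simp: frac_1_eq)

lemma frac_cf_rem_add_one: "frac (cf_rem (x + 1) n) = frac (cf_rem x n)"
  by (cases n) (auto simp: frac_1_eq simp del: cf_rem.simps(2) simp: cf_rem_add_one)

lemma minkowski_F_add_one:
  assumes "x \<ge> 0"
  shows "minkowski_F (x + 1) = (1 + minkowski_F x) / 2"
proof -
  \<comment> \<open>Only the zeroth element changes, growing by one, so every exponent grows by one
    and every term is halved. Nonnegativity of \<open>x\<close> keeps \<open>nat\<close> from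
    truncating.\<close>
  have elem0: "cf_elem (x + 1) 0 = Suc (cf_elem x 0)"
    using assms by (simp add: cf_elem_def) (simp add: nat_add_distrib)
  have elem: "cf_elem (x + 1) (Suc n) = cf_elem x (Suc n)" for n
    by (simp add: cf_elem_def cf_rem_add_one del: cf_rem.simps)
  have "(\<Sum>k\<le>n. cf_elem (x + 1) k) = Suc (\<Sum>k\<le>n. cf_elem x k)" for n
    by (induction n) (auto simp: elem0 elem)
  then have "cf_term (x + 1) n = (1/2) * cf_term x n" for n
    by (simp add: cf_term_def cf_defined_def frac_cf_rem_add_one)
  then have "(\<Sum>n. cf_term (x + 1) n) = (1/2) * (\<Sum>n. cf_term x n)"
    by (simp only: suminf_mult[OF summable_cf_term])
  then show ?thesis using assms by (simp add: minkowski_F_nonneg_eq field_simps)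
qed

text \<open>For \<open>0 < x < 1\<close> the expansion of \<open>x\<close> is that of
  \<open>1 / x\<close> with a 0 prepended. The exponents stay the same, the indices shift by one and
  flip all signs, and the new leading term is -1.\<close>

lemma minkowski_F_inverse_less_one:
  assumes "0 < x" "x < 1"
  shows "minkowski_F (1 / x) = 1 - minkowski_F x"
proof -
  have frac: "frac x = x" using assms by (simp add: frac_eq)
  have rem: "cf_rem x (Suc n) = cf_rem (1 / x) n" for n
    by (induction n) (auto simp: frac)
  have elem0: "cf_elem x 0 = 0" using assms by (simp add: cf_elem_def floor_eq_iff)
  have elem: "cf_elem x (Suc n) = cf_elem (1 / x) n" for n
    by (simp add: cf_elem_def rem del: cf_rem.simps)
  have "(\<Sum>k\<le>Suc n. cf_elem x k) = (\<Sum>k\<le>n. cf_elem (1 / x) k)" for n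
    by (simp add: sum.atMost_Suc_shift elem0 elem del: sum.atMost_Suc)
  \<comment> \<open>The additional condition at index 0 is \<open>frac x \<noteq> 0\<close>, which
    holds since \<open>frac x = x > 0\<close>.\<close>
  moreover have "cf_defined x (Suc n) = cf_defined (1 / x) n" for n
    unfolding cf_defined_def All_less_Suc2
    using assms rem by (simp add: frac del: cf_rem.simps(2))
  ultimately have "cf_term x (Suc n) = - cf_term (1 / x) n" for n
    by (simp add: cf_term_def del: sum.atMost_Suc)
  moreover have "cf_term x 0 = - 1"
    by (simp add: cf_term_def cf_defined_def elem0)
  ultimately have "(\<Sum>n. cf_term x n) = - 1 - (\<Sum>n. cf_term (1 / x) n)"
    using suminf_split_head[OF summable_cf_term[of x]]
      suminf_minus[OF summable_cf_term[of "1 / x"]] by simp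
  then show ?thesis using assms by (simp add: minkowski_F_nonneg_eq)
qed

lemma minkowski_F_zero [simp]: "minkowski_F 0 = 0"
proof -
  have "cf_term 0 n = (if n = 0 then - 1 else 0)" for n
    by (cases n) (auto simp: cf_term_def cf_defined_def cf_elem_def All_less_Suc2)
  then have "suminf (cf_term 0) = - 1"
    using suminf_finite[of "{0}" "cf_term 0"] by simp
  then show ?thesis
    using minkowski_F_nonneg_eq[of 0] by linarith
qed

lemma minkowski_F_one: "minkowski_F 1 = 1 / 2"
  using minkowski_F_add_one[of 0] by simp

lemma minkowski_F_inverse:
  assumes "x > 0"
  shows "minkowski_F (1 / x) = 1 - minkowski_F x"
proof -
  consider "x < 1" | "x = 1" | "x > 1" by linarith
  then show ?thesis
  proof cases
    case 3
    then have "minkowski_F (1 / (1 / x)) = 1 - minkowski_F (1 / x)"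
      by (intro minkowski_F_inverse_less_one) auto
    then show ?thesis by simp
  qed (use assms minkowski_F_inverse_less_one[of x] minkowski_F_one in simp_all)
qed

lemma minkowski_F_div_add_one:
  assumes "x \<ge> 0"
  shows "minkowski_F (x / (x + 1)) = minkowski_F x / 2"
proof (cases "x = 0")
  case False
  with assms have x: "x > 0" by simp
  have "x / (x + 1) = 1 / (1 / x + 1)"
    using x by (simp add: divide_simps)
  then have "minkowski_F (x / (x + 1)) = 1 - minkowski_F (1 / x + 1)"
    using minkowski_F_inverse[of "1 / x + 1"] x by (simp only:) (simp add: add_pos_pos)
  also have "\<dots> = minkowski_F x / 2"
    using minkowski_F_add_one[of "1 / x"] minkowski_F_inverse[OF x] x by auto
  finally show ?thesis .
qed simp

section \<open>Range and monotonicity by error halving\<close>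

lemma div_add_one_strict_mono: "0 \<le> x \<Longrightarrow> x < y \<Longrightarrow> x / (x + 1) < y / (y + 1 :: real)"
  by (simp add: field_simps)

text \<open>The induction step of all halving arguments: \<open>x\<close> is pulled back along one
  of the two increasing branches, on each of which \<open>F\<close> is contracted by 1/2.\<close>

lemma nonneg_real_cases [consumes 1, case_names lt ge]:
  fixes x :: real
  assumes "x \<ge> 0"
  obtains y where "y \<ge> 0" "x = y / (y + 1)" "x < 1" | y where "y \<ge> 0" "x = y + 1" "x \<ge> 1"
proof (cases "x < 1")
  case True
  then show ?thesis using assms that(1)[of "x / (1 - x)"] by (simp add: field_simps)
next
  case False
  then show ?thesis using that(2)[of "x - 1"] by simp
qed

text \<open>Both \<open>t / 2\<close> and \<open>(1 + t) / 2\<close> map the interval from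
  \<open>-e\<close> to \<open>1 + e\<close> into the one with \<open>e / 2\<close> in place of
  \<open>e\<close>.\<close>

lemma minkowski_F_approx_bounds:
  assumes "x \<ge> 0"
  shows "- (3 / 2 ^ n) \<le> minkowski_F x \<and> minkowski_F x \<le> 1 + 3 / 2 ^ n"
  using assms
proof (induction n arbitrary: x)
  case 0
  then show ?case using abs_minkowski_F_le[of x] by auto
next
  case (Suc n)
  have "(0::real) \<le> 3 / 2 ^ n" by simp
  from Suc.prems show ?case
  proof (cases x rule: nonneg_real_cases)
    case (lt y)
    then show ?thesis using Suc.IH[of y] by (simp add: minkowski_F_div_add_one)
  next
    case (ge y)
    then show ?thesis using Suc.IH[of y] \<open>0 \<le> 3 / 2 ^ n\<close>
      by (simp add: minkowski_F_add_one)
  qed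
qed

lemma le_if_le_add_inverse_power2:
  fixes a b c :: real
  assumes "\<And>n. a \<le> b + c / 2 ^ n"
  shows "a \<le> b"
proof -
  have "(\<lambda>n. b + c * (1/2) ^ n) \<longlonglongrightarrow> b + c * 0"
    by (intro tendsto_intros LIMSEQ_realpow_zero) auto
  then have "(\<lambda>n. b + c / 2 ^ n) \<longlonglongrightarrow> b" by (simp add: power_divide)
  then show ?thesis
    by (rule LIMSEQ_le_const) (use assms in blast)
qed

lemma minkowski_F_nonneg: "minkowski_F x \<ge> 0"
proof (cases "x < 0")
  case False
  have "- minkowski_F x \<le> 0"
    by (rule le_if_le_add_inverse_power2[of _ _ 3])
       (use minkowski_F_approx_bounds[of x] False in \<open>force simp: minus_le_iff\<close>)
  then show ?thesis by simp
qed (simp add: minkowski_F_def)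

lemma minkowski_F_le_one: "minkowski_F x \<le> 1"
proof (cases "x < 0")
  case False
  show ?thesis
    by (rule le_if_le_add_inverse_power2[of _ _ 3])
       (use minkowski_F_approx_bounds[of x] False in force)
qed (simp add: minkowski_F_def)

text \<open>Points on the same side of 1 share a branch, and the error is halved. For points on
  different sides the value 1/2 separates the two images.\<close>

lemma minkowski_F_mono_approx:
  assumes "0 \<le> x" "x \<le> y"
  shows "minkowski_F x \<le> minkowski_F y + 1 / 2 ^ n"
  using assms
proof (induction n arbitrary: x y)
  case 0
  then show ?case using minkowski_F_le_one[of x] minkowski_F_nonneg[of y] by simp
next
  case (Suc n)
  from Suc.prems have "y \<ge> 0" by simp
  from Suc.prems(1) show ?case
  proof (cases x rule: nonneg_real_cases)
    case x: (lt x')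
    from \<open>y \<ge> 0\<close> show ?thesis
    proof (cases y rule: nonneg_real_cases)
      case y: (lt y')
      have "x' \<le> y'" using Suc.prems(2) x y by (simp add: field_simps)
      then show ?thesis using Suc.IH[of x' y'] x y by (simp add: minkowski_F_div_add_one)
    next
      case y: (ge y')
      have "minkowski_F x = minkowski_F x' / 2" "minkowski_F y = (1 + minkowski_F y') / 2"
        using x y by (simp_all add: minkowski_F_div_add_one minkowski_F_add_one)
      then have "minkowski_F x \<le> minkowski_F y"
        using minkowski_F_le_one[of x'] minkowski_F_nonneg[of y'] by simp
      then show ?thesis by (rule order_trans) simp
    qed
  next
    case x: (ge x')
    from \<open>y \<ge> 0\<close> show ?thesis
    proof (cases y rule: nonneg_real_cases)
      case y: (lt y')
      then show ?thesis using Suc.prems(2) x by simp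
    next
      case y: (ge y')
      then show ?thesis using Suc.IH[of x' y'] Suc.prems(2) x
        by (simp add: minkowski_F_add_one add_divide_distrib)
    qed
  qed
qed

lemma minkowski_F_mono: "x \<le> y \<Longrightarrow> minkowski_F x \<le> minkowski_F y"
proof (cases "x < 0")
  case True
  then show ?thesis using minkowski_F_nonneg[of y] by (simp add: minkowski_F_def[of x])
next
  case False
  assume "x \<le> y"
  then show ?thesis
    using False by (intro le_if_le_add_inverse_power2[OF minkowski_F_mono_approx]) auto
qed

section \<open>Continuity and limits at infinity\<close>

lemma minkowski_F_of_nat: "minkowski_F (real n) = 1 - 1 / 2 ^ n"
proof (induction n)
  case (Suc n)
  have "minkowski_F (real (Suc n)) = minkowski_F (real n + 1)" by (simp add: add.commute)
  then show ?case using Suc.IH by (simp only: minkowski_F_add_one of_nat_0_le_iff) simp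
qed simp

lemma tendsto_one_minus_inverse_power2: "(\<lambda>n. 1 - 1 / 2 ^ n :: real) \<longlonglongrightarrow> 1"
  using tendsto_diff[OF tendsto_const LIMSEQ_realpow_zero[of "1/2::real"], of 1]
  by (simp add: power_divide)

text \<open>A point to the right of the preimage is carried by the same strictly increasing branch
  to a point to the right of \<open>x\<close>, and the gap in \<open>F\<close> is halved.\<close>

lemma minkowski_F_right_approx:
  assumes "x \<ge> 0"
  shows "\<exists>y>x. minkowski_F y \<le> minkowski_F x + 1 / 2 ^ n"
  using assms
proof (induction n arbitrary: x)
  case 0
  have "minkowski_F (x + 1) \<le> minkowski_F x + 1"
    using minkowski_F_le_one[of "x + 1"] minkowski_F_nonneg[of x] by linarith
  then show ?case by (intro exI[of _ "x + 1"]) simp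
next
  case (Suc n)
  from Suc.prems show ?case
  proof (cases x rule: nonneg_real_cases)
    case x: (lt x')
    with Suc.IH[of x'] obtain y where y: "y > x'" "minkowski_F y \<le> minkowski_F x' + 1 / 2 ^ n"
      by auto
    then have "y / (y + 1) > x" using x div_add_one_strict_mono[of x' y] by simp
    then show ?thesis using x y
      by (intro exI[of _ "y / (y + 1)"]) (simp add: minkowski_F_div_add_one)
  next
    case x: (ge x')
    with Suc.IH[of x'] obtain y where y: "y > x'" "minkowski_F y \<le> minkowski_F x' + 1 / 2 ^ n"
      by auto
    then show ?thesis using x
      by (intro exI[of _ "y + 1"]) (simp add: minkowski_F_add_one add_divide_distrib)
  qed
qed

lemma minkowski_F_left_approx:
  assumes "x > 0"
  shows "\<exists>y\<ge>0. y < x \<and> minkowski_F x \<le> minkowski_F y + 1 / 2 ^ n"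
  using assms
proof (induction n arbitrary: x)
  case 0
  then show ?case using minkowski_F_le_one[of x] by (intro exI[of _ 0]) simp
next
  case (Suc n)
  from Suc.prems have "x \<ge> 0" by simp
  then show ?case
  proof (cases x rule: nonneg_real_cases)
    case x: (lt x')
    then have "x' > 0" using Suc.prems by (cases "x' = 0") auto
    with Suc.IH[of x'] obtain y
      where y: "y \<ge> 0" "y < x'" "minkowski_F x' \<le> minkowski_F y + 1 / 2 ^ n" by auto
    then have "y / (y + 1) < x" using x div_add_one_strict_mono[of y x'] by simp
    then show ?thesis using x y
      by (intro exI[of _ "y / (y + 1)"]) (simp add: minkowski_F_div_add_one)
  next
    case x: (ge x')
    show ?thesis
    proof (cases "x' = 0")
      \<comment> \<open>At \<open>x = 1\<close> the shift branch has no point to the left, so the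
        approximants come from the other branch: \<open>n / (n + 1)\<close> has value 1/2 minus
        exactly \<open>1 / 2 ^ Suc n\<close>.\<close>
      case True
      have "minkowski_F (real n / (real n + 1)) = (1 - 1 / 2 ^ n) / 2"
        using minkowski_F_div_add_one[of "real n"] by (simp only: minkowski_F_of_nat of_nat_0_le_iff)
      then show ?thesis using x True
        by (intro exI[of _ "real n / (real n + 1)"]) (simp add: minkowski_F_one diff_divide_distrib)
    next
      case False
      with x Suc.IH[of x'] obtain y
        where y: "y \<ge> 0" "y < x'" "minkowski_F x' \<le> minkowski_F y + 1 / 2 ^ n" by auto
      then show ?thesis using x
        by (intro exI[of _ "y + 1"]) (simp add: minkowski_F_add_one add_divide_distrib)
    qed
  qed
qed

lemma ex_inverse_power2_less: "e > 0 \<Longrightarrow> \<exists>n. 1 / 2 ^ n < (e::real)"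
  using real_arch_pow_inv[of e "1/2"] by (simp add: power_divide)

lemma minkowski_F_continuous_at_right: "continuous (at_right a) minkowski_F"
  unfolding continuous_within
proof (rule order_tendstoI)
  fix b assume b: "b < minkowski_F a"
  have "b < minkowski_F x" if "a < x" for x
    using b minkowski_F_mono[of a x] that by linarith
  then show "\<forall>\<^sub>F x in at_right a. b < minkowski_F x"
    by (simp add: eventually_at_filter)
next
  fix b assume b: "minkowski_F a < b"
  \<comment> \<open>By monotonicity, one such point controls \<open>F\<close> on the whole interval
    between \<open>a\<close> and \<open>y\<close>.\<close>
  have "\<exists>y>a. minkowski_F y < b"
  proof (cases "a < 0")
    case True
    then show ?thesis using b by (intro exI[of _ "a / 2"]) (simp add: minkowski_F_def)
  next
    case False
    obtain n where "1 / 2 ^ n < b - minkowski_F a"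
      using ex_inverse_power2_less[of "b - minkowski_F a"] b by auto
    with False minkowski_F_right_approx[of a n] show ?thesis by force
  qed
  then obtain y where y: "y > a" "minkowski_F y < b" by blast
  show "\<forall>\<^sub>F x in at_right a. minkowski_F x < b"
    using eventually_at_right_real[OF y(1)]
    by eventually_elim (auto intro: le_less_trans[OF minkowski_F_mono y(2)])
qed

lemma minkowski_F_continuous_at_left: "continuous (at_left a) minkowski_F"
  unfolding continuous_within
proof (rule order_tendstoI)
  fix b assume b: "minkowski_F a < b"
  have "minkowski_F x < b" if "x < a" for x
    using b minkowski_F_mono[of x a] that by linarith
  then show "\<forall>\<^sub>F x in at_left a. minkowski_F x < b"
    by (simp add: eventually_at_filter)
next
  fix b assume b: "b < minkowski_F a"
  have "\<exists>y<a. b < minkowski_F y"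
  proof (cases "a \<le> 0")
    case True
    then have "minkowski_F a = 0" by (cases "a = 0") (simp, simp add: minkowski_F_def)
    then show ?thesis using b True by (intro exI[of _ "a - 1"]) (simp add: minkowski_F_def)
  next
    case False
    obtain n where "1 / 2 ^ n < minkowski_F a - b"
      using ex_inverse_power2_less[of "minkowski_F a - b"] b by auto
    with False minkowski_F_left_approx[of a n] show ?thesis by force
  qed
  then obtain y where y: "y < a" "b < minkowski_F y" by blast
  show "\<forall>\<^sub>F x in at_left a. b < minkowski_F x"
    using eventually_at_left_real[OF y(1)]
    by eventually_elim (auto intro: less_le_trans[OF y(2) minkowski_F_mono])
qed

lemma isCont_minkowski_F: "isCont minkowski_F a"
  by (simp add: continuous_at_split minkowski_F_continuous_at_left minkowski_F_continuous_at_right)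

lemma minkowski_F_at_bot: "(minkowski_F \<longlongrightarrow> 0) at_bot"
proof (rule tendsto_eventually)
  show "\<forall>\<^sub>F x in at_bot. minkowski_F x = 0"
    using eventually_gt_at_bot[of "0::real"] by eventually_elim (simp add: minkowski_F_def)
qed

lemma minkowski_F_at_top: "(minkowski_F \<longlongrightarrow> 1) at_top"
  by (rule tendsto_at_topI_sequentially_real)
     (use tendsto_one_minus_inverse_power2 in
        \<open>simp_all add: mono_def minkowski_F_mono minkowski_F_of_nat\<close>)

section \<open>The Stieltjes measure and its symmetries\<close>

text \<open>If \<open>c \<cdot> M\<close> restricted to \<open>A\<close> has the same distribution function as the image of \<open>M\<close>
  under \<open>T\<close>, then the two measures agree.\<close>

lemma (in real_distribution) integral_transform:
  fixes f :: "real \<Rightarrow> complex"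
  assumes A [measurable]: "A \<in> sets borel"
    and T [measurable]: "T \<in> borel_measurable borel"
    and f [measurable]: "f \<in> borel_measurable borel"
    and c: "c \<ge> 0"
    and cdf: "\<And>t. c * prob (A \<inter> {..t}) = prob {x. T x \<le> t}"
  shows "(\<integral>x. f (T x) \<partial>M) = (\<integral>x. (c * indicator A x) *\<^sub>R f x \<partial>M)"
proof -
  define N where "N = density M (\<lambda>x. ennreal (c * indicator A x))"
  have sets_N: "sets N = sets borel" by (simp add: N_def)
  have emeasure_N: "emeasure N B = ennreal (c * prob (A \<inter> B))" if [measurable]: "B \<in> sets borel" for B
  proof -
    have "emeasure N B = (\<integral>\<^sup>+x. ennreal c * indicator (A \<inter> B) x \<partial>M)"
      unfolding N_def
      by (subst emeasure_density) (auto intro!: nn_integral_cong simp: indicator_def)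
    also have "\<dots> = ennreal c * emeasure M (A \<inter> B)"
      by (subst nn_integral_cmult_indicator) auto
    finally show ?thesis using c by (simp add: emeasure_eq_measure ennreal_mult)
  qed
  have "space N = UNIV" using sets_eq_imp_space_eq[OF sets_N] by simp
  then have "finite_measure N" using emeasure_N[of UNIV] by (intro finite_measureI) simp
  \<comment> \<open>The total mass of \<open>N\<close> is \<open>c * prob A\<close>, not known
    beforehand to be 1, so uniqueness is applied in its form for finite measures.\<close>
  then have "finite_borel_measure N"
    by (simp add: finite_borel_measure_def finite_borel_measure_axioms_def sets_N)
  moreover have "finite_borel_measure (distr M borel T)"
    using real_distribution_distr[of T] real_distribution.finite_borel_measure_M by simp
  moreover have "cdf N = cdf (distr M borel T)"
  proof
    fix t
    have "cdf N t = c * prob (A \<inter> {..t})"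
      using c by (simp add: cdf_def measure_def[of N] emeasure_N)
    also have "\<dots> = cdf (distr M borel T) t"
      by (simp add: cdf cdf_def measure_distr vimage_def)
    finally show "cdf N t = cdf (distr M borel T) t" .
  qed
  ultimately have eq: "N = distr M borel T" by (rule cdf_unique')
  have "(\<integral>x. f (T x) \<partial>M) = (\<integral>x. f x \<partial>distr M borel T)"
    by (subst integral_distr) auto
  also have "\<dots> = (\<integral>x. (c * indicator A x) *\<^sub>R f x \<partial>M)"
    unfolding eq[symmetric] N_def using c by (subst integral_density) auto
  finally show ?thesis .
qed

section \<open>Half-lines and null sets of \<open>dF\<close>\<close>

abbreviation (input) minkowski_measure :: "real measure" where
  "minkowski_measure \<equiv> interval_measure minkowski_F"

interpretation minkowski: real_distribution minkowski_measure
  by (intro real_distribution_interval_measure minkowski_F_mono minkowski_F_continuous_at_right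
      minkowski_F_at_bot minkowski_F_at_top)

lemma prob_atMost: "minkowski.prob {..t} = minkowski_F t"
  using cdf_interval_measure[OF minkowski_F_mono minkowski_F_continuous_at_right minkowski_F_at_bot]
  by (simp add: cdf_def fun_eq_iff)

text \<open>Continuity of \<open>F\<close> excludes atoms, so strict and weak half-lines have equal
  mass.\<close>

lemma prob_singleton: "minkowski.prob {t} = 0"
proof -
  have "cdf minkowski_measure = minkowski_F" by (simp add: fun_eq_iff cdf_def prob_atMost)
  then show ?thesis using minkowski.isCont_cdf[of t] isCont_minkowski_F by simp
qed

lemma prob_lessThan: "minkowski.prob {..<t} = minkowski_F t"
proof -
  have "minkowski.prob {..t} = minkowski.prob {..<t} + minkowski.prob {t}"
    by (subst minkowski.finite_measure_Union[symmetric]) (auto intro: arg_cong[where f = minkowski.prob])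
  then show ?thesis by (simp add: prob_atMost prob_singleton)
qed

lemma prob_atLeast: "minkowski.prob {t..} = 1 - minkowski_F t"
proof -
  have "{t..} = space minkowski_measure - {..<t}" by auto
  then show ?thesis using minkowski.prob_compl[of "{..<t}"] by (simp add: prob_lessThan)
qed

text \<open>Since \<open>F 0 = 0\<close>, identities and set equalities need checking only at
  positive points, away from the default values of division by zero.\<close>

lemma AE_pos: "AE x in minkowski_measure. 0 < x"
proof -
  have "{..0} \<in> null_sets minkowski_measure"
    by (auto simp: null_sets_def minkowski.emeasure_eq_measure prob_atMost)
  then show ?thesis by (rule AE_mp[OF AE_not_in]) auto
qed

lemma AE_minkowskiI: "(\<And>x. x > 0 \<Longrightarrow> P x) \<Longrightarrow> AE x in minkowski_measure. P x"
  using AE_pos by (rule AE_mp) simp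

lemma prob_AE_eq:
  assumes "\<And>x. x > 0 \<Longrightarrow> x \<in> A \<longleftrightarrow> x \<in> B" "A \<in> sets borel" "B \<in> sets borel"
  shows "minkowski.prob A = minkowski.prob B"
  by (rule minkowski.finite_measure_eq_AE) (use assms AE_pos in auto)

section \<open>Invariance and self-similarity of \<open>dF\<close>\<close>

lemma minkowski_F_eq_zero: "t \<le> 0 \<Longrightarrow> minkowski_F t = 0"
  using minkowski_F_mono[of t 0] minkowski_F_nonneg[of t] by simp

text \<open>For \<open>x > 0\<close>, \<open>1 / x \<le> t\<close> means
  \<open>x \<ge> 1 / t\<close>, a half-line of mass \<open>1 - F (1 / t) = F t\<close>.\<close>

lemma integral_inverse:
  fixes f :: "real \<Rightarrow> complex"
  assumes "f \<in> borel_measurable borel"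
  shows "(\<integral>x. f (1 / x) \<partial>minkowski_measure) = (\<integral>x. f x \<partial>minkowski_measure)"
proof -
  have "1 * minkowski.prob (UNIV \<inter> {..t}) = minkowski.prob {x. 1 / x \<le> t}" for t
  proof (cases "t > 0")
    case True
    then have "minkowski.prob {x. 1 / x \<le> t} = minkowski.prob {1 / t..}"
      by (intro prob_AE_eq) (auto simp: field_simps)
    then show ?thesis using minkowski_F_inverse[OF True] by (simp add: prob_atLeast prob_atMost)
  next
    case False
    then have "minkowski.prob {x. 1 / x \<le> t} = minkowski.prob {}"
      by (intro prob_AE_eq) (auto simp: not_less not_le intro: le_less_trans)
    then show ?thesis using False by (simp add: prob_atMost minkowski_F_eq_zero)
  qed
  from minkowski.integral_transform[OF _ _ assms _ this] show ?thesis by simp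
qed

text \<open>For \<open>t \<ge> 1\<close>, the functional equation reads
  \<open>2 * (F t - F 1) = F (t - 1)\<close>.\<close>

lemma integral_add_one:
  fixes f :: "real \<Rightarrow> complex"
  assumes "f \<in> borel_measurable borel"
  shows "(\<integral>x. f (x + 1) \<partial>minkowski_measure) =
    (\<integral>x. (2 * indicator {1..} x) *\<^sub>R f x \<partial>minkowski_measure)"
proof (rule minkowski.integral_transform[OF _ _ assms])
  show "2 * minkowski.prob ({1..} \<inter> {..t}) = minkowski.prob {x. x + 1 \<le> t}" for t
  proof -
    have eq: "{x. x + 1 \<le> t} = {..t - 1}" by auto
    show ?thesis
    proof (cases "t < 1")
      case True
      then have "{1..} \<inter> {..t} = {}" by auto
      then show ?thesis using True unfolding eq by (simp add: prob_atMost minkowski_F_eq_zero)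
    next
      case False
      have "minkowski.prob {..t} = minkowski.prob ({..<1} \<union> ({1..} \<inter> {..t}))"
        using False by (intro arg_cong[where f = minkowski.prob]) auto
      also have "\<dots> = minkowski.prob {..<1} + minkowski.prob ({1..} \<inter> {..t})"
        by (intro minkowski.finite_measure_Union) auto
      finally show ?thesis
        using False minkowski_F_add_one[of "t - 1"] unfolding eq
        by (simp add: prob_atMost prob_lessThan minkowski_F_one)
    qed
  qed
qed auto

lemma integral_div_add_one:
  fixes f :: "real \<Rightarrow> complex"
  assumes "f \<in> borel_measurable borel"
  shows "(\<integral>x. f (x / (x + 1)) \<partial>minkowski_measure) =
    (\<integral>x. (2 * indicator {..<1} x) *\<^sub>R f x \<partial>minkowski_measure)"
proof (rule minkowski.integral_transform[OF _ _ assms])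
  show "2 * minkowski.prob ({..<1} \<inter> {..t}) = minkowski.prob {x. x / (x + 1) \<le> t}" for t
  proof (cases "t < 1")
    case lt: True
    then have eq: "{..<1} \<inter> {..t} = {..t}" by auto
    show ?thesis
    proof (cases "t < 0")
      case True
      have "minkowski.prob {x. x / (x + 1) \<le> t} = minkowski.prob {}"
        using True by (intro prob_AE_eq) (auto simp: not_le intro: less_trans)
      then show ?thesis using True unfolding eq by (simp add: prob_atMost minkowski_F_eq_zero)
    next
      case False
      \<comment> \<open>The bound \<open>t / (1 - t)\<close> is the preimage of \<open>t\<close>
        under \<open>x / (x + 1)\<close>.\<close>
      have "minkowski.prob {x. x / (x + 1) \<le> t} = minkowski.prob {..t / (1 - t)}"
        using lt False by (intro prob_AE_eq) (auto simp: field_simps)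
      moreover have "t / (1 - t) / (t / (1 - t) + 1) = t"
        using lt by (simp add: field_simps)
      ultimately show ?thesis
        using minkowski_F_div_add_one[of "t / (1 - t)"] lt False unfolding eq
        by (simp add: prob_atMost)
    qed
  next
    case False
    then have eq: "{..<1} \<inter> {..t} = {..<1}" by auto
    have "minkowski.prob {x. x / (x + 1) \<le> t} = minkowski.prob UNIV"
      using False by (intro prob_AE_eq) (auto intro: order_trans[of _ 1])
    also have "\<dots> = 1" using minkowski.prob_space by simp
    finally show ?thesis unfolding eq by (simp add: prob_lessThan minkowski_F_one)
  qed
qed auto

text \<open>The two image measures live on complementary half-lines and each equals twice
  \<open>dF\<close> there, so they add up to \<open>2 dF\<close>.\<close>

lemma integral_self_similar:
  fixes f :: "real \<Rightarrow> complex"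
  assumes f: "f \<in> borel_measurable borel" and int: "integrable minkowski_measure f"
  shows "2 * (\<integral>x. f x \<partial>minkowski_measure) =
    (\<integral>x. f (x + 1) \<partial>minkowski_measure) + (\<integral>x. f (x / (x + 1)) \<partial>minkowski_measure)"
proof -
  have int2: "integrable minkowski_measure (\<lambda>x. (2 * indicator B x) *\<^sub>R f x)"
    if "B \<in> sets borel" for B :: "real set"
    using integrable_scaleR_right[where c = 2, OF integrable_mult_indicator[OF _ int, of B]] that
    by simp
  have "(2 * indicator {1..} x) *\<^sub>R f x + (2 * indicator {..<1} x) *\<^sub>R f x = 2 * f x" for x
    by (auto simp: indicator_def scaleR_conv_of_real)
  then show ?thesis
    unfolding integral_add_one[OF f] integral_div_add_one[OF f]
    by (subst Bochner_Integration.integral_add[symmetric]) (auto simp: int2)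
qed

section \<open>The generating function\<close>

abbreviation (input) branch_cut :: "complex set" where
  "branch_cut \<equiv> complex_of_real ` {1..}"

text \<open>The kernel is the sum of \<open>z ^ n / (x + 1) ^ Suc n\<close>, whose coefficients
  integrate to the moments after inversion.\<close>

definition minkowski_G :: "complex \<Rightarrow> complex" where
  "minkowski_G z = (\<integral>x. 1 / (of_real x + 1 - z) \<partial>minkowski_measure)"

lemma closed_branch_cut: "closed branch_cut"
  by (intro closed_injective_linear_image) (auto simp: inj_def linear_of_real)

text \<open>The pole \<open>x + 1\<close> of the kernel lies on the cut, so the distance to the cut
  bounds the denominator below. Integrability, expansion and decay all rest on this.\<close>

lemma infdist_branch_cut_le: "x \<ge> 0 \<Longrightarrow> infdist z branch_cut \<le> norm (of_real x + 1 - z)"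
  by (rule infdist_le2[OF imageI[of "x + 1"]]) (auto simp: dist_norm norm_minus_commute)

lemma infdist_branch_cut_pos: "z \<notin> branch_cut \<Longrightarrow> 0 < infdist z branch_cut"
  by (intro infdist_pos_not_in_closed closed_branch_cut) auto

lemma norm_kernel_le:
  assumes "z \<notin> branch_cut" "x \<ge> 0"
  shows "norm (1 / (of_real x + 1 - z)) \<le> 1 / infdist z branch_cut"
  using infdist_branch_cut_le[OF assms(2), of z] infdist_branch_cut_pos[OF assms(1)]
  by (simp add: norm_divide frac_le)

lemma integrable_kernel:
  assumes "z \<notin> branch_cut"
  shows "integrable minkowski_measure (\<lambda>x. 1 / (of_real x + 1 - z))"
proof (rule minkowski.integrable_const_bound)
  show "AE x in minkowski_measure. norm (1 / (of_real x + 1 - z)) \<le> 1 / infdist z branch_cut"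
    using AE_pos by eventually_elim (rule norm_kernel_le[OF assms], simp)
qed measurable

lemma norm_minkowski_G_le:
  assumes "z \<notin> branch_cut"
  shows "norm (minkowski_G z) \<le> 1 / infdist z branch_cut"
proof -
  have "norm (minkowski_G z) \<le> (\<integral>x. norm (1 / (of_real x + 1 - z)) \<partial>minkowski_measure)"
    unfolding minkowski_G_def by (rule integral_norm_bound)
  also have "\<dots> \<le> 1 / infdist z branch_cut"
  proof (rule minkowski.integral_le_const)
    show "AE x in minkowski_measure. norm (1 / (of_real x + 1 - z)) \<le> 1 / infdist z branch_cut"
      using AE_pos by eventually_elim (rule norm_kernel_le[OF assms], simp)
  qed (intro integrable_norm integrable_kernel assms)
  finally show ?thesis .
qed

text \<open>The kernel is expanded as a geometric series with ratio
  \<open>(w - z) / (x + 1 - z)\<close>, at most \<open>r < 1\<close> in norm uniformly in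
  \<open>x > 0\<close>, so sum and integral may be exchanged. Arbitrary \<open>z\<close> gives
  analyticity, and \<open>z = 0\<close> gives the moment series.\<close>

lemma minkowski_G_power_series:
  assumes z: "z \<notin> branch_cut" and w: "w \<in> ball z (infdist z branch_cut)"
  shows "(\<lambda>n. (\<integral>x. 1 / (of_real x + 1 - z) ^ Suc n \<partial>minkowski_measure) * (w - z) ^ n)
    sums minkowski_G w"
proof -
  define d where "d = infdist z branch_cut"
  define r where "r = norm (w - z) / d"
  define f where "f n x = 1 / (complex_of_real x + 1 - z) ^ Suc n * (w - z) ^ n" for n x
  have d: "d > 0" unfolding d_def by (rule infdist_branch_cut_pos[OF z])
  have r: "0 \<le> r" "r < 1"
    using w d by (auto simp: r_def d_def dist_norm norm_minus_commute)
  have f_bound: "norm (f n x) \<le> r ^ n / d" if "x > 0" for n x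
  proof -
    have "norm (f n x) = (norm (1 / (of_real x + 1 - z))) ^ Suc n * norm (w - z) ^ n"
      by (simp add: f_def norm_mult norm_divide norm_power power_divide)
    also have "\<dots> \<le> (1 / d) ^ Suc n * norm (w - z) ^ n"
      using norm_kernel_le[OF z, of x] that
      by (intro mult_right_mono power_mono) (auto simp: d_def)
    finally show ?thesis by (simp add: r_def power_divide field_simps)
  qed
  have f_int: "integrable minkowski_measure (f n)" for n
  proof (rule minkowski.integrable_const_bound)
    show "AE x in minkowski_measure. norm (f n x) \<le> r ^ n / d"
      using AE_pos by eventually_elim (rule f_bound)
    show "f n \<in> borel_measurable minkowski_measure" unfolding f_def by measurable
  qed
  have f_int_bound: "(\<integral>x. norm (f n x) \<partial>minkowski_measure) \<le> r ^ n / d" for n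
  proof (rule minkowski.integral_le_const)
    show "AE x in minkowski_measure. norm (f n x) \<le> r ^ n / d"
      using AE_pos by eventually_elim (rule f_bound)
  qed (intro integrable_norm f_int)
  have geometric: "summable (\<lambda>n. r ^ n / d)"
    using r by (intro summable_divide summable_geometric) auto
  have f_summable: "AE x in minkowski_measure. summable (\<lambda>n. norm (f n x))"
    using AE_pos
    by eventually_elim (rule summable_comparison_test'[OF geometric, of 0], simp add: f_bound)
  have int_summable: "summable (\<lambda>n. \<integral>x. norm (f n x) \<partial>minkowski_measure)"
    by (rule summable_comparison_test'[OF geometric, of 0]) (use f_int_bound in simp)
  have "f n x = 1 / (of_real x + 1 - z) * ((w - z) / (of_real x + 1 - z)) ^ n" for n x
    by (simp add: f_def power_divide)
  moreover have "(\<Sum>n. 1 / (of_real x + 1 - z) * ((w - z) / (of_real x + 1 - z)) ^ n) =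
      1 / (of_real x + 1 - w)" if "x > 0" for x :: real
  proof -
    define u where "u = complex_of_real x + 1 - z"
    have "d \<le> norm u" using infdist_branch_cut_le[of x z] that by (simp add: u_def d_def)
    moreover have "norm (w - z) < d" using r d by (simp add: r_def)
    ultimately have u: "u \<noteq> 0" "norm ((w - z) / u) < 1" "u \<noteq> w - z"
      using d by (auto simp: norm_divide divide_less_eq_1)
    have "(\<lambda>n. 1 / u * ((w - z) / u) ^ n) sums (1 / u * (1 / (1 - (w - z) / u)))"
      by (intro sums_mult geometric_sums u)
    also have "1 / u * (1 / (1 - (w - z) / u)) = 1 / (u - (w - z))"
      using u by (simp add: field_simps)
    also have "u - (w - z) = of_real x + 1 - w" by (simp add: u_def)
    finally show ?thesis by (simp add: sums_iff u_def)
  qed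
  ultimately have "AE x in minkowski_measure. (\<Sum>n. f n x) = 1 / (of_real x + 1 - w)"
    by (intro AE_minkowskiI) simp
  then have "(\<integral>x. (\<Sum>n. f n x) \<partial>minkowski_measure) = minkowski_G w"
    unfolding minkowski_G_def
    by (rule integral_cong_AE[rotated 2])
       (simp_all add: borel_measurable_integrable[OF integrable_suminf[OF f_int f_summable int_summable]])
  then have "(\<lambda>n. \<integral>x. f n x \<partial>minkowski_measure) sums minkowski_G w"
    using sums_integral[OF f_int f_summable int_summable] by simp
  then show ?thesis by (simp only: f_def integral_mult_left_zero)
qed

lemma minkowski_G_analytic: "minkowski_G analytic_on (- branch_cut)"
  unfolding analytic_on_def
proof
  fix z assume "z \<in> - branch_cut"
  then have z: "z \<notin> branch_cut" by simp
  have "minkowski_G holomorphic_on ball z (infdist z branch_cut)"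
    by (rule power_series_holomorphic) (rule minkowski_G_power_series[OF z])
  then show "\<exists>e>0. minkowski_G holomorphic_on ball z e"
    using infdist_branch_cut_pos[OF z] by blast
qed

lemma of_real_minkowski_moment:
  "complex_of_real (minkowski_moment L) = (\<integral>x. 1 / (of_real x + 1) ^ L \<partial>minkowski_measure)"
proof -
  have "complex_of_real (minkowski_moment L) =
      (\<integral>x. of_real (indicator {0..} x * (x / (x + 1)) ^ L) \<partial>minkowski_measure)"
    by (simp only: minkowski_moment_def set_lebesgue_integral_def integral_complex_of_real
        real_scaleR_def)
  \<comment> \<open>Writing \<open>x / (x + 1)\<close> as \<open>1 / (1 / x + 1)\<close> exposes the
    inversion, which then replaces \<open>1 / x\<close> by \<open>x\<close>.\<close>
  also have "\<dots> = (\<integral>x. 1 / (of_real (1 / x) + 1) ^ L \<partial>minkowski_measure)"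
  proof (rule integral_cong_AE)
    have "x / (x + 1) = 1 / (1 / x + 1)" if "x > 0" for x :: real
      using that by (simp add: field_simps)
    then have "of_real (indicator {0..} x * (x / (x + 1)) ^ L)
        = 1 / (complex_of_real (1 / x) + 1) ^ L" if "x > 0" for x :: real
      using that by (simp add: power_divide)
    then show "AE x in minkowski_measure. of_real (indicator {0..} x * (x / (x + 1)) ^ L)
        = 1 / (complex_of_real (1 / x) + 1) ^ L"
      by (rule AE_minkowskiI)
  qed simp_all
  also have "\<dots> = (\<integral>x. 1 / (of_real x + 1) ^ L \<partial>minkowski_measure)"
    by (rule integral_inverse) simp
  finally show ?thesis .
qed

lemma minkowski_G_sums:
  assumes "norm z < 1"
  shows "(\<lambda>n. complex_of_real (minkowski_moment (Suc n)) * z ^ n) sums minkowski_G z"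
proof -
  \<comment> \<open>Hence the unit disc lies inside the ball of expansion about 0.\<close>
  have "1 \<le> infdist 0 branch_cut"
    by (subst infdist_notempty) (auto intro!: cINF_greatest)
  moreover have "0 \<notin> branch_cut" by auto
  ultimately show ?thesis
    using minkowski_G_power_series[of 0 z] assms
    by (simp add: of_real_minkowski_moment del: power_Suc)
qed

section \<open>The functional equations and decay of \<open>G\<close>\<close>

lemma add_one_in_branch_cut_iff: "z + 1 \<in> branch_cut \<longleftrightarrow> z \<in> complex_of_real ` {0..}"
proof
  assume "z + 1 \<in> branch_cut"
  then obtain x where "x \<ge> 1" "z + 1 = of_real x" by auto
  then have "z = of_real (x - 1)" by (simp add: algebra_simps)
  then show "z \<in> complex_of_real ` {0..}" using \<open>x \<ge> 1\<close> by (intro image_eqI[of _ _ "x - 1"]) auto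
next
  assume "z \<in> complex_of_real ` {0..}"
  then obtain x where "x \<ge> 0" "z = of_real x" by auto
  then show "z + 1 \<in> branch_cut" by (intro image_eqI[of _ _ "x + 1"]) auto
qed

text \<open>Self-similarity applied to \<open>f x = 1 / (x - z)\<close>: the integral of
  \<open>f\<close> is \<open>G (z + 1)\<close>, its shift gives \<open>G z\<close>, and the branch
  \<open>x / (x + 1)\<close> gives the terms with \<open>1 / (1 - z)\<close>.\<close>

lemma minkowski_G_functional_equation:
  assumes z: "z \<notin> complex_of_real ` {0..}"
  shows "- (1 / (1 - z)) - 1 / (1 - z)\<^sup>2 * minkowski_G (1 / (1 - z)) + 2 * minkowski_G (z + 1)
    = minkowski_G z"
proof -
  define f where "f x = 1 / (complex_of_real x - z)" for x
  have "z \<noteq> 1" using z by (auto intro: image_eqI[of _ _ 1])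
  define v where "v = 1 - z"
  have "v \<noteq> 0" using \<open>z \<noteq> 1\<close> by (simp add: v_def)
  \<comment> \<open>If \<open>1 / (1 - z) = x \<ge> 1\<close>, then \<open>z = 1 - 1 / x\<close>
    would be a nonnegative real.\<close>
  have v: "1 / v \<notin> branch_cut"
  proof
    assume "1 / v \<in> branch_cut"
    then obtain x where x: "x \<ge> 1" "1 / v = of_real x" by auto
    then have "z = of_real (1 - 1 / x)" using \<open>v \<noteq> 0\<close> by (simp add: v_def field_simps)
    moreover have "1 - 1 / x \<ge> 0" using x by simp
    ultimately show False using z by blast
  qed
  have int: "integrable minkowski_measure f"
    using integrable_kernel[of "z + 1"] z by (simp add: add_one_in_branch_cut_iff f_def[abs_def])
  have [measurable]: "f \<in> borel_measurable borel" unfolding f_def by simp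
  \<comment> \<open>With \<open>u = x + 1\<close> the left side is \<open>u / (u * v - 1)\<close>,
    and the right side is its partial fraction decomposition in \<open>u\<close>.\<close>
  have "f (x / (x + 1)) = 1 / v + 1 / v\<^sup>2 * (1 / (of_real x + 1 - 1 / v))" if "x > 0" for x :: real
  proof -
    define u where "u = complex_of_real (x + 1)"
    have "u \<noteq> 0" using that unfolding u_def by (subst of_real_eq_0_iff) simp
    have "u - 1 / v \<noteq> 0"
      using v that by (auto simp: u_def intro!: image_eqI[of _ _ "x + 1"])
    then have uv: "u * v - 1 \<noteq> 0" using \<open>v \<noteq> 0\<close> by (auto simp: field_simps)
    have "f (x / (x + 1)) = 1 / ((u - 1) / u - (1 - v))"
      by (simp add: f_def u_def v_def)
    also have "(u - 1) / u - (1 - v) = (u * v - 1) / u"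
      using \<open>u \<noteq> 0\<close> by (simp add: field_simps)
    also have "1 / \<dots> = 1 / v + 1 / v\<^sup>2 * (1 / ((u * v - 1) / v))"
      using \<open>v \<noteq> 0\<close> uv by (simp add: divide_simps power2_eq_square)
    also have "(u * v - 1) / v = of_real x + 1 - 1 / v"
      using \<open>v \<noteq> 0\<close> by (simp add: u_def field_simps)
    finally show ?thesis .
  qed
  then have "(\<integral>x. f (x / (x + 1)) \<partial>minkowski_measure) =
      (\<integral>x. 1 / v + 1 / v\<^sup>2 * (1 / (of_real x + 1 - 1 / v)) \<partial>minkowski_measure)"
    by (intro integral_cong_AE AE_minkowskiI) auto
  also have "\<dots> = 1 / v + 1 / v\<^sup>2 * minkowski_G (1 / v)"
  proof -
    define k where "k x = 1 / (complex_of_real x + 1 - 1 / v)" for x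
    have "integrable minkowski_measure k" unfolding k_def by (rule integrable_kernel[OF v])
    then have "(\<integral>x. 1 / v + 1 / v\<^sup>2 * k x \<partial>minkowski_measure) =
        1 / v + 1 / v\<^sup>2 * (\<integral>x. k x \<partial>minkowski_measure)"
      using minkowski.prob_space by (subst Bochner_Integration.integral_add) simp_all
    then show ?thesis by (simp only: k_def minkowski_G_def)
  qed
  finally have "(\<integral>x. f (x / (x + 1)) \<partial>minkowski_measure) = 1 / v + 1 / v\<^sup>2 * minkowski_G (1 / v)" .
  moreover have "(\<integral>x. f x \<partial>minkowski_measure) = minkowski_G (z + 1)"
    by (simp add: minkowski_G_def f_def)
  moreover have "(\<integral>x. f (x + 1) \<partial>minkowski_measure) = minkowski_G z"
    by (simp add: minkowski_G_def f_def)
  ultimately show ?thesis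
    using integral_self_similar[OF _ int] by (simp add: v_def)
qed

text \<open>Inversion invariance applied to \<open>1 / (x - z)\<close>: the inverted kernel
  \<open>x / (1 - z * x)\<close> splits into a constant and a multiple of the kernel with pole at
  \<open>1 / z\<close>.\<close>

lemma minkowski_G_symmetry:
  assumes z: "z \<notin> complex_of_real ` {0..}"
  shows "minkowski_G (z + 1) = - (1 / z\<^sup>2) * minkowski_G (1 / z + 1) - 1 / z"
proof -
  have "z \<noteq> 0" using z by (auto intro: image_eqI[of _ _ 0])
  have z': "1 / z + 1 \<notin> branch_cut"
  proof
    assume "1 / z + 1 \<in> branch_cut"
    then obtain x where x: "x \<ge> 0" "1 / z = of_real x" by (auto simp: add_one_in_branch_cut_iff)
    then have "z = of_real (1 / x)" by (metis div_by_1 divide_divide_eq_right mult_1 of_real_1 of_real_divide)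
    then show False using z x by (auto intro: image_eqI[of _ _ "1 / x"])
  qed
  define k where "k x = 1 / (complex_of_real x + 1 - (1 / z + 1))" for x
  have int: "integrable minkowski_measure k"
    unfolding k_def by (rule integrable_kernel[OF z'])
  have "minkowski_G (z + 1) = (\<integral>x. 1 / (of_real x - z) \<partial>minkowski_measure)"
    by (simp add: minkowski_G_def)
  also have "\<dots> = (\<integral>x. 1 / (of_real (1 / x) - z) \<partial>minkowski_measure)"
    by (rule integral_inverse[symmetric]) simp
  also have "\<dots> = (\<integral>x. - (1 / z\<^sup>2) * k x - 1 / z \<partial>minkowski_measure)"
  proof (rule integral_cong_AE)
    have "1 / (complex_of_real (1 / x) - z) = - (1 / z\<^sup>2) * k x - 1 / z" if "x > 0" for x :: real
    proof -
      define u where "u = complex_of_real x"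
      have "u \<noteq> 0" using that by (simp add: u_def)
      have "z \<noteq> of_real (1 / x)" using z that by (auto intro: image_eqI[of _ _ "1 / x"])
      then have uz: "1 - z * u \<noteq> 0" using \<open>u \<noteq> 0\<close> by (auto simp: u_def field_simps)
      have "1 / (complex_of_real (1 / x) - z) = 1 / ((1 - z * u) / u)"
        using \<open>u \<noteq> 0\<close> by (simp add: u_def field_simps)
      also have "\<dots> = - (1 / z\<^sup>2) * (1 / (- (1 - z * u) / z)) - 1 / z"
        using \<open>z \<noteq> 0\<close> \<open>u \<noteq> 0\<close> uz
        by (simp add: divide_simps power2_eq_square) (simp add: algebra_simps)
      also have "- (1 - z * u) / z = of_real x + 1 - (1 / z + 1)"
        using \<open>z \<noteq> 0\<close> by (simp add: u_def field_simps)
      finally show ?thesis by (simp only: k_def)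
    qed
    then show "AE x in minkowski_measure.
        1 / (complex_of_real (1 / x) - z) = - (1 / z\<^sup>2) * k x - 1 / z"
      by (rule AE_minkowskiI)
  qed (auto simp: k_def)
  also have "\<dots> = - (1 / z\<^sup>2) * minkowski_G (1 / z + 1) - 1 / z"
  proof -
    have "minkowski_G (1 / z + 1) = (\<integral>x. k x \<partial>minkowski_measure)"
      by (simp only: minkowski_G_def k_def)
    then show ?thesis
      using minkowski.prob_space int by (subst Bochner_Integration.integral_diff) simp_all
  qed
  finally show ?thesis .
qed

lemma minkowski_G_tendsto_0:
  "(minkowski_G \<longlongrightarrow> 0) (filtercomap (\<lambda>z. infdist z (complex_of_real ` {0..})) at_top)"
proof (rule Lim_null_comparison)
  let ?d = "\<lambda>z. infdist z (complex_of_real ` {0..})"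
  have dist: "filterlim ?d at_top (filtercomap ?d at_top)" by (rule filterlim_filtercomap)
  then have "\<forall>\<^sub>F z in filtercomap ?d at_top. 0 < ?d z"
    by (simp add: filterlim_at_top_dense)
  then show "\<forall>\<^sub>F z in filtercomap ?d at_top. norm (minkowski_G z) \<le> inverse (?d z)"
  proof eventually_elim
    case (elim z)
    \<comment> \<open>The cut is a subset of the nonnegative half-line, hence at least as far away,
      and the kernel bound carries over.\<close>
    have le: "?d z \<le> infdist z branch_cut"
      by (rule infdist_mono) auto
    then have "z \<notin> branch_cut" using elim by auto
    then have "norm (minkowski_G z) \<le> 1 / infdist z branch_cut" by (rule norm_minkowski_G_le)
    also have "\<dots> \<le> inverse (?d z)" using le elim by (simp add: field_simps)
    finally show ?case .
  qed
  show "((\<lambda>z. inverse (?d z)) \<longlongrightarrow> 0) (filtercomap ?d at_top)"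
    by (rule tendsto_inverse_0_at_top[OF dist])
qed

theorem theorem1:
  "\<exists>G :: complex \<Rightarrow> complex.
     (\<forall>z. norm z < 1 \<longrightarrow>
        (\<lambda>n. complex_of_real (minkowski_moment (Suc n)) * z ^ n) sums G z) \<and>
     G analytic_on (- complex_of_real ` {1..}) \<and>
     (\<forall>z. z \<notin> complex_of_real ` {0..} \<longrightarrow>
        - (1 / (1 - z)) - 1 / (1 - z)\<^sup>2 * G (1 / (1 - z)) + 2 * G (z + 1) = G z) \<and>
     (\<forall>z. z \<notin> complex_of_real ` {0..} \<longrightarrow>
        G (z + 1) = - (1 / z\<^sup>2) * G (1 / z + 1) - 1 / z) \<and>
     (G \<longlongrightarrow> 0) (filtercomap (\<lambda>z. infdist z (complex_of_real ` {0..})) at_top)"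
  using minkowski_G_sums minkowski_G_analytic minkowski_G_functional_equation
    minkowski_G_symmetry minkowski_G_tendsto_0
  by blast

end
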